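(* Let $N\ge2$ and let $\mathbf A\in\mathbb R^{N\times N}$ be symmetric with $\operatorname{rank}(\mathbf A)>1$, with eigenvalues $|\lambda_0|\ge|\lambda_1|\ge\dots\ge|\lambda_{N-1}|$ and a corresponding orthonormal basis of eigenvectors $\mathbf v_0,\dots,\mathbf v_{N-1}$, and assume $\lambda_0=\|\mathbf A\|_2>|\lambda_1|$. Let $\mathbf H_1=\tilde c\,\tilde{\mathbf z}\tilde{\mathbf z}^T$, with $\tilde c\in\mathbb R$, $\tilde z\in\overline{\mathbb R}$, $\tilde{\mathbf z}=\mathbf z(\tilde z)$, be an optimal rank-1 Hankel approximation of $\mathbf A$ in the spectral norm, i.e. a minimizer of $\|\mathbf A-c\,\mathbf z(z)\mathbf z(z)^T\|_2$ over $c\in\mathbb R$, $z\in\overline{\mathbb R}$. (1) The optimal error bound $\|\mathbf A-\tilde c\,\tilde{\mathbf z}\tilde{\mathbf z}^T\|_2^2=\lambda_1^2$ is achieved if and only if there exists $\tilde z\in\overline{\mathbb R}$ such that $$\mathbf v_j^T\tilde{\mathbf z}=0\ \text{ for all } j \text{ with } |\lambda_j|=|\lambda_1|,\qquad\text{and}\qquad f(\tilde z,\lambda_1^2)\ge0,\qquad(\mathrm i)$$ and $\tilde c$ is chosen such that $$\sum_{j=0}^{N-1}{}^{'}\ \frac{(\mathbf v_j^T\tilde{\mathbf z})^2}{\lambda_j+|\lambda_1|}\ \le\ \frac1{\tilde c}\ \le\ \sum_{j=0}^{N-1}{}^{'}\ \frac{(\mathbf v_j^T\tilde{\mathbf z})^2}{\lambda_j-|\lambda_1|};\qquad(\mathrm{ii})$$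 that is, parameters $\tilde z\in\overline{\mathbb R}$, $\tilde c\in\mathbb R\setminus\{0\}$ achieve this error if and only if $\tilde z$ satisfies (i) and $\tilde c$ satisfies (ii). (2) If there is no $\tilde z\in\overline{\mathbb R}$ satisfying (i), then the optimal rank-1 Hankel approximation of $\mathbf A$ has the error $\tilde\lambda:=\|\mathbf A-\tilde c\,\tilde{\mathbf z}\tilde{\mathbf z}^T\|_2\in(|\lambda_1|,\lambda_0)$, where $\tilde\lambda$ is the minimal number in $(|\lambda_1|,\lambda_0)$ satisfying $$\max_{z\in\overline{\mathbb R}}f(z,\tilde\lambda^2)=0,$$ and $\tilde z\in\mathop{\mathrm{argmax}}_{z\in\overline{\mathbb R}}f(z,\tilde\lambda^2)$. Further, $$\tilde c=\Bigl(\sum_{k=0}^{N-1}\frac{(\mathbf v_k^T\tilde{\mathbf z})^2}{\lambda_k-\tilde\lambda}\Bigr)^{-1}=\bigl(\tilde{\mathbf z}^T(\mathbf A-\tilde\lambda\mathbf I)^{-1}\tilde{\mathbf z}\bigr)^{-1}>0.$$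
   Context: $\overline{\mathbb R}:=\mathbb R\cup\{\infty\}$. For $z\in\mathbb R$, $\mathbf z(z):=\bigl(\sum_{k=0}^{N-1}z^{2k}\bigr)^{-1/2}(1,z,\dots,z^{N-1})^T\in\mathbb R^N$, and $\mathbf z(\infty):=\mathbf e_N=(0,\dots,0,1)^T$. (The matrices $c\,\mathbf z(z)\mathbf z(z)^T$ with $c\in\mathbb R\setminus\{0\}$, $z\in\overline{\mathbb R}$ are exactly the real symmetric $N\times N$ Hankel matrices of rank 1.) $\|\cdot\|_2$ is the spectral norm. The symbol $\sum'$ denotes a sum in which all terms of the form $\frac00$ are omitted. For $z\in\overline{\mathbb R}$ and $\lambda^2\in[\lambda_1^2,\lambda_0^2)$, $$f(z,\lambda^2):=\sum_{j=0}^{N-1}{}^{'}\ \frac{(\mathbf v_j^T\mathbf z(z))^2}{\lambda_j^2-\lambda^2},$$ where for $\lambda^2=\lambda_1^2$ this is used only when $\mathbf v_j^T\mathbf z(z)=0$ for all $j$ with $\lambda_j^2=\lambda_1^2$. *)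

theory Defs
  imports "HOL-Analysis.Analysis"
begin

text \<open>
  The order \<open>N\<close> of the matrices is \<open>CARD('n)\<close>. Hankel structure needs an ordered index set, so \<open>'n\<close>
  is a finite linearly ordered type; \<open>pos i\<close> is the zero-based position of the index \<open>i\<close>.
\<close>

definition pos :: "'n::{finite,linorder} \<Rightarrow> nat" where
  "pos i = card {j. j < i}"

text \<open>The real line with a single point at infinity (unlike \<open>ereal\<close>, which has two).\<close>

datatype rbar = Fin real | Infty

fun zvec :: "rbar \<Rightarrow> real ^ 'n::{finite,linorder}" where
  "zvec (Fin z) = (1 / sqrt (\<Sum>k<CARD('n). z ^ (2 * k))) *\<^sub>R (\<chi> i. z ^ pos i)"
| "zvec Infty = axis (Max UNIV) 1"

definition hankel1 :: "real \<Rightarrow> rbar \<Rightarrow> real ^ 'n::{finite,linorder} ^ 'n::{finite,linorder}" where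
  "hankel1 c z = c *\<^sub>R (\<chi> i j. zvec z $ i * zvec z $ j)"

definition spectral_norm :: "real ^ 'n ^ 'n \<Rightarrow> real" where
  "spectral_norm A = onorm ((*v) A)"

definition optimal_hankel1 :: "real ^ 'n::{finite,linorder} ^ 'n::{finite,linorder} \<Rightarrow> real \<Rightarrow> rbar \<Rightarrow> bool" where
  "optimal_hankel1 A c z \<longleftrightarrow>
     is_arg_min (\<lambda>(c, z). spectral_norm (A - hankel1 c z)) (\<lambda>_. True) (c, z)"

text \<open>The primed sum: the sum of the quotients \<open>a j / b j\<close> in which all terms \<open>0 / 0\<close> are omitted.\<close>

definition sum_primed :: "(nat \<Rightarrow> real) \<Rightarrow> (nat \<Rightarrow> real) \<Rightarrow> nat set \<Rightarrow> real" where
  "sum_primed a b J = (\<Sum>j\<in>{j \<in> J. \<not> (a j = 0 \<and> b j = 0)}. a j / b j)"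

text \<open>
  The function \<open>f(z, s)\<close> with \<open>s = \<lambda>\<^sup>2\<close>, for the eigenvalues \<open>lam j\<close> and eigenvectors \<open>v j\<close>, \<open>j < N\<close>.
  It is meaningful for \<open>(lam 1)\<^sup>2 < s < (lam 0)\<^sup>2\<close>, and for \<open>s = (lam 1)\<^sup>2\<close> only when \<open>zvec z\<close> is
  orthogonal to every \<open>v j\<close> with \<open>(lam j)\<^sup>2 = s\<close>; otherwise a term with nonzero numerator is divided by
  zero. \<open>cond_i\<close> contains this orthogonality.
\<close>

definition ffun :: "(nat \<Rightarrow> real) \<Rightarrow> (nat \<Rightarrow> real ^ 'n::{finite,linorder}) \<Rightarrow> rbar \<Rightarrow> real \<Rightarrow> real" where
  "ffun lam v z s =
     sum_primed (\<lambda>j. (v j \<bullet> zvec z)\<^sup>2) (\<lambda>j. (lam j)\<^sup>2 - s) {..<CARD('n)}"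

definition cond_i :: "(nat \<Rightarrow> real) \<Rightarrow> (nat \<Rightarrow> real ^ 'n::{finite,linorder}) \<Rightarrow> rbar \<Rightarrow> bool" where
  "cond_i lam v z \<longleftrightarrow>
     (\<forall>j<CARD('n). \<bar>lam j\<bar> = \<bar>lam 1\<bar> \<longrightarrow> v j \<bullet> zvec z = 0) \<and> ffun lam v z ((lam 1)\<^sup>2) \<ge> 0"

definition cond_ii ::
  "(nat \<Rightarrow> real) \<Rightarrow> (nat \<Rightarrow> real ^ 'n::{finite,linorder}) \<Rightarrow> rbar \<Rightarrow> real \<Rightarrow> bool" where
  "cond_ii lam v z c \<longleftrightarrow>
     sum_primed (\<lambda>j. (v j \<bullet> zvec z)\<^sup>2) (\<lambda>j. lam j + \<bar>lam 1\<bar>) {..<CARD('n)} \<le> 1 / c \<and>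
     1 / c \<le> sum_primed (\<lambda>j. (v j \<bullet> zvec z)\<^sup>2) (\<lambda>j. lam j - \<bar>lam 1\<bar>) {..<CARD('n)}"

text \<open>\<open>max\<^sub>z F z = m\<close>, including that the maximum is attained.\<close>

definition has_max :: "('a \<Rightarrow> real) \<Rightarrow> real \<Rightarrow> bool" where
  "has_max F m \<longleftrightarrow> (\<exists>z. is_arg_max F (\<lambda>_. True) z \<and> F z = m)"

end

(* In the eigenbasis, norm (A - c z z^T) <= mu means that the quadratic forms mu I + A - c z z^T and
   mu I - A + c z z^T are nonnegative. For |lam 1| <= mu < lam 0 the first is a positive diagonal form
   minus a rank-one form, the second has a single negative diagonal entry that the rank-one form must
   compensate; by Cauchy-Schwarz they hold iff c > 0 and
     T = sum_j (v_j . z)^2 / (lam_j + mu) <= 1/c <= S = sum_j (v_j . z)^2 / (lam_j - mu),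
   with z orthogonal to every v_j with |lam_j| = mu. Since S - T = 2 mu f(z, mu^2) and T > 0, some c
   works for a given z iff this orthogonality holds and f(z, mu^2) >= 0. The case mu = |lam 1| is
   part (1). In part (2), f(z, mu^2) > 0 at the optimal error mu would by continuity allow a smaller
   error, so the maximum of f(., mu^2) is 0 and S = T = 1/c. *)
theory Submission
  imports Defs
begin

subsection \<open>Diagonal quadratic forms and rank-one forms\<close>

text \<open>Cauchy-Schwarz for the vectors \<open>a j / sqrt (d j)\<close> and
  \<open>sqrt (d j) * x j\<close>. Zero weights are admissible because there \<open>a j = 0\<close>,
  and the quotient by zero has the value 0.\<close>

lemma weighted_Cauchy_Schwarz:
  fixes a d x :: "'i \<Rightarrow> real"
  assumes "\<And>j. j \<in> J \<Longrightarrow> d j \<ge> 0" and "\<And>j. j \<in> J \<Longrightarrow> d j = 0 \<Longrightarrow> a j = 0"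
  shows "(\<Sum>j\<in>J. a j * x j)\<^sup>2 \<le> (\<Sum>j\<in>J. (a j)\<^sup>2 / d j) * (\<Sum>j\<in>J. d j * (x j)\<^sup>2)"
proof -
  have "(\<Sum>j\<in>J. a j * x j) = (\<Sum>j\<in>J. (a j / sqrt (d j)) * (sqrt (d j) * x j))"
    using assms by (intro sum.cong) auto
  moreover have "(\<Sum>j\<in>J. (a j / sqrt (d j))\<^sup>2) = (\<Sum>j\<in>J. (a j)\<^sup>2 / d j)"
    using assms by (intro sum.cong) (auto simp: power_divide)
  moreover have "(\<Sum>j\<in>J. (sqrt (d j) * x j)\<^sup>2) = (\<Sum>j\<in>J. d j * (x j)\<^sup>2)"
    using assms by (intro sum.cong) (auto simp: power_mult_distrib)
  ultimately show ?thesis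
    using Cauchy_Schwarz_ineq_sum[of "\<lambda>j. a j / sqrt (d j)" "\<lambda>j. sqrt (d j) * x j" J] by simp
qed

text \<open>Weighted Cauchy-Schwarz is sharp: its bound is attained at
  \<open>x j = a j / d j\<close>, which gives the condition on \<open>1 / c\<close>. A direction
  with \<open>d j = 0\<close> and \<open>a j \<noteq> 0\<close> would make the left side positive
  and the right side zero.\<close>

lemma diagonal_dominates_rank_one_iff:
  fixes a d :: "'i \<Rightarrow> real"
  assumes fin: "finite J" and d: "\<And>j. j \<in> J \<Longrightarrow> d j \<ge> 0" and c: "c > 0"
  shows "(\<forall>x. c * (\<Sum>j\<in>J. a j * x j)\<^sup>2 \<le> (\<Sum>j\<in>J. d j * (x j)\<^sup>2)) \<longleftrightarrow>
         (\<forall>j\<in>J. d j = 0 \<longrightarrow> a j = 0) \<and> (\<Sum>j\<in>J. (a j)\<^sup>2 / d j) \<le> 1 / c"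
    (is "?L \<longleftrightarrow> ?R")
proof
  assume L: ?L
  let ?T = "\<Sum>j\<in>J. (a j)\<^sup>2 / d j"
  have zero: "a j = 0" if j: "j \<in> J" "d j = 0" for j
  proof -
    have "(\<Sum>k\<in>J. a k * (if k = j then 1 else 0)) = a j"
      using fin j by (simp add: if_distrib cong: if_cong)
    moreover have "(\<Sum>k\<in>J. d k * (if k = j then 1 else 0)\<^sup>2) = 0"
      using j by (intro sum.neutral) auto
    ultimately have "c * (a j)\<^sup>2 \<le> 0"
      using L[rule_format, of "\<lambda>k. if k = j then 1 else 0"] by simp
    then show ?thesis using c by (simp add: mult_le_0_iff)
  qed
  \<comment> \<open>At the extremal vector of Cauchy-Schwarz both sums equal \<open>?T\<close>;
    indices with \<open>d j = 0\<close> contribute 0 to each.\<close>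
  have "(\<Sum>j\<in>J. a j * (a j / d j)) = ?T"
    by (simp add: power2_eq_square)
  moreover have "(\<Sum>j\<in>J. d j * (a j / d j)\<^sup>2) = ?T"
    by (intro sum.cong) (auto simp: power2_eq_square)
  ultimately have *: "c * ?T\<^sup>2 \<le> ?T"
    using L[rule_format, of "\<lambda>j. a j / d j"] by simp
  have "T \<le> 1 / c" if "c * T\<^sup>2 \<le> T" for T
  proof (cases "T > 0")
    case True
    then have "c * T \<le> 1" using that by (simp add: power2_eq_square)
    then show ?thesis using c by (simp add: field_simps)
  next
    case False
    then show ?thesis using c by (smt (verit) divide_pos_pos)
  qed
  from this[OF *] show ?R using zero by blast
next
  assume R: ?R
  show ?L
  proof
    fix x
    have D: "0 \<le> (\<Sum>j\<in>J. d j * (x j)\<^sup>2)" using d by (simp add: sum_nonneg)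
    have "c * (\<Sum>j\<in>J. a j * x j)\<^sup>2 \<le> c * ((\<Sum>j\<in>J. (a j)\<^sup>2 / d j) * (\<Sum>j\<in>J. d j * (x j)\<^sup>2))"
      using weighted_Cauchy_Schwarz[of J d a x] d R c by (intro mult_left_mono) auto
    also have "\<dots> \<le> c * (1 / c * (\<Sum>j\<in>J. d j * (x j)\<^sup>2))"
      using R c D by (intro mult_left_mono mult_right_mono) auto
    finally show "c * (\<Sum>j\<in>J. a j * x j)\<^sup>2 \<le> (\<Sum>j\<in>J. d j * (x j)\<^sup>2)" using c by simp
  qed
qed

text \<open>With \<open>x i = 1\<close> fixed, the right-hand side has minimum
  \<open>c * (a i)\<^sup>2 / (1 + c * S)\<close> over the other coordinates, where \<open>S\<close>
  is the sum of the \<open>(a j)\<^sup>2 / d j\<close>. Requiring this to be at least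
  \<open>e\<close> is the stated inequality; the converse is weighted Cauchy-Schwarz.\<close>

lemma rank_one_lifts_negative_square_iff:
  fixes a d :: "'i \<Rightarrow> real"
  assumes fin: "finite J" and i: "i \<notin> J" and d: "\<And>j. j \<in> J \<Longrightarrow> d j \<ge> 0" and e: "e > 0"
  shows "(\<forall>x. e * (x i)\<^sup>2 \<le> (\<Sum>j\<in>J. d j * (x j)\<^sup>2) + c * (a i * x i + (\<Sum>j\<in>J. a j * x j))\<^sup>2) \<longleftrightarrow>
         c > 0 \<and> (\<forall>j\<in>J. d j = 0 \<longrightarrow> a j = 0) \<and> (\<Sum>j\<in>J. (a j)\<^sup>2 / d j) + 1 / c \<le> (a i)\<^sup>2 / e"
    (is "?L \<longleftrightarrow> ?R")
proof
  assume L: ?L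
  let ?S = "\<Sum>j\<in>J. (a j)\<^sup>2 / d j"
  \<comment> \<open>Testing the \<open>i\<close>-th unit vector leaves only the rank-one term to
    compensate \<open>e\<close>, so \<open>c\<close> must be positive.\<close>
  have "e \<le> c * (a i)\<^sup>2"
  proof -
    have "(\<Sum>j\<in>J. a j * (if j = i then 1 else 0)) = 0" "(\<Sum>j\<in>J. d j * (if j = i then 1 else 0)\<^sup>2) = 0"
      using i by (auto intro!: sum.neutral)
    then show ?thesis
      using L[rule_format, of "\<lambda>j. if j = i then 1 else 0"] by simp
  qed
  then have c: "c > 0" using e
    by (smt (verit) mult_nonpos_nonneg zero_le_power2)
  have zero: "a j = 0" if j: "j \<in> J" "d j = 0" for j
  proof (rule ccontr)
    assume "a j \<noteq> 0"
    \<comment> \<open>A vector orthogonal to \<open>a\<close> on which the diagonal part vanishes.\<close>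
    define x where "x = (\<lambda>k. if k = i then 1 else if k = j then - a i / a j else 0)"
    have "(\<Sum>k\<in>J. a k * x k) = (\<Sum>k\<in>J. if k = j then - a i else 0)"
      using i \<open>a j \<noteq> 0\<close> by (intro sum.cong) (auto simp: x_def)
    then have "a i * x i + (\<Sum>k\<in>J. a k * x k) = 0"
      using fin j by (simp add: x_def)
    moreover have "(\<Sum>k\<in>J. d k * (x k)\<^sup>2) = 0"
      using i j by (intro sum.neutral) (auto simp: x_def)
    ultimately show False
      using L[rule_format, of x] e by (simp add: x_def)
  qed
  have S: "?S \<ge> 0" using d by (intro sum_nonneg) simp
  have pos: "1 + c * ?S > 0" using S c by (smt (verit) mult_nonneg_nonneg)
  \<comment> \<open>The minimizer of the right-hand side over the coordinates in \<open>J\<close>, with the other one fixed to 1.\<close>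
  define s where "s = - c * a i / (1 + c * ?S)"
  define x where "x = (\<lambda>k. if k = i then 1 else s * (a k / d k))"
  have "(\<Sum>k\<in>J. a k * x k) = s * ?S"
    using i by (auto simp: x_def sum_distrib_left power2_eq_square intro!: sum.cong)
  moreover have "(\<Sum>k\<in>J. d k * (x k)\<^sup>2) = s\<^sup>2 * ?S"
    using i by (auto simp: x_def sum_distrib_left power2_eq_square intro!: sum.cong)
  ultimately have "e \<le> s\<^sup>2 * ?S + c * (a i + s * ?S)\<^sup>2"
    using L[rule_format, of x] by (simp add: x_def)
  also have "a i + s * ?S = a i / (1 + c * ?S)"
    using pos by (simp add: s_def field_simps)
  also have "s\<^sup>2 * ?S + c * (a i / (1 + c * ?S))\<^sup>2 = c * (a i)\<^sup>2 * (1 + c * ?S) / (1 + c * ?S)\<^sup>2"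
    unfolding s_def by (simp add: power_divide power_mult_distrib add_divide_distrib[symmetric])
      (simp add: algebra_simps power2_eq_square)
  also have "\<dots> = c * (a i)\<^sup>2 / (1 + c * ?S)"
    using pos by (simp add: power2_eq_square)
  finally have "e * (1 + c * ?S) \<le> c * (a i)\<^sup>2"
    using pos by (simp add: field_simps)
  then have "?S + 1 / c \<le> (a i)\<^sup>2 / e"
    using c e by (simp add: field_simps)
  then show ?R using c zero by blast
next
  assume R: ?R
  then have c: "c > 0" by simp
  show ?L
  proof
    fix x
    let ?t = "a i * x i + (\<Sum>j\<in>J. a j * x j)"
    let ?D = "(\<Sum>j\<in>J. d j * (x j)\<^sup>2) + c * ?t\<^sup>2"
    have D: "?D \<ge> 0" using d c by (intro add_nonneg_nonneg sum_nonneg) auto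
    \<comment> \<open>Cauchy--Schwarz for \<open>a i * x i = 1 * ?t - (\<Sum>j\<in>J. a j * x j)\<close>, with weight \<open>c\<close> on the first term.\<close>
    define a' where "a' = a(i := 1)"
    define d' where "d' = d(i := c)"
    define x' where "x' = (\<lambda>j. if j = i then ?t else - x j)"
    have on_J: "a' j = a j" "d' j = d j" "x' j = - x j" if "j \<in> J" for j
      using that i by (auto simp: a'_def d'_def x'_def)
    have "(\<Sum>j\<in>insert i J. a' j * x' j)\<^sup>2 \<le>
        (\<Sum>j\<in>insert i J. (a' j)\<^sup>2 / d' j) * (\<Sum>j\<in>insert i J. d' j * (x' j)\<^sup>2)"
      using R d by (intro weighted_Cauchy_Schwarz) (auto simp: a'_def d'_def)
    moreover have "(\<Sum>j\<in>insert i J. a' j * x' j) = a i * x i"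
      using fin i by (simp add: on_J sum_negf) (simp add: a'_def x'_def)
    moreover have "(\<Sum>j\<in>insert i J. (a' j)\<^sup>2 / d' j) = (\<Sum>j\<in>J. (a j)\<^sup>2 / d j) + 1 / c"
      using fin i by (simp add: on_J) (simp add: a'_def d'_def)
    moreover have "(\<Sum>j\<in>insert i J. d' j * (x' j)\<^sup>2) = ?D"
      using fin i by (simp add: on_J) (simp add: d'_def x'_def)
    ultimately have "(a i * x i)\<^sup>2 \<le> ((\<Sum>j\<in>J. (a j)\<^sup>2 / d j) + 1 / c) * ?D"
      by simp
    also have "\<dots> \<le> (a i)\<^sup>2 / e * ?D"
      using R D by (intro mult_right_mono) auto
    finally have *: "(a i)\<^sup>2 * (e * (x i)\<^sup>2) \<le> (a i)\<^sup>2 * ?D"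
      using e by (simp add: field_simps power_mult_distrib)
    \<comment> \<open>The factor \<open>(a i)\<^sup>2\<close> can be cancelled in \<open>*\<close>:
      the hypothesis bounds \<open>(a i)\<^sup>2 / e\<close> below by \<open>1 / c\<close>, which is
      positive.\<close>
    have "0 \<le> (\<Sum>j\<in>J. (a j)\<^sup>2 / d j)" using d by (intro sum_nonneg) simp
    then have "(a i)\<^sup>2 / e > 0" using R c by (smt (verit) divide_pos_pos)
    then have "(a i)\<^sup>2 > 0" using e by (simp add: zero_less_divide_iff)
    with * show "e * (x i)\<^sup>2 \<le> ?D" by simp
  qed
qed

subsection \<open>The spectral norm of symmetric matrices\<close>

text \<open>Kept free of the Hankel structure, so that the analysis in an eigenbasis covers every
  vector \<open>z\<close> and needs no order on the matrix indices.\<close>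

definition outer :: "real ^ 'n \<Rightarrow> real ^ 'n ^ 'n" where
  "outer z = (\<chi> i j. z $ i * z $ j)"

lemma outer_mult_vec: "outer z *v x = (z \<bullet> x) *\<^sub>R z"
  by (simp add: outer_def matrix_vector_mult_def vec_eq_iff inner_vec_def sum_distrib_left
      algebra_simps)

lemma transpose_outer: "transpose (outer z) = outer z"
  by (simp add: outer_def transpose_def vec_eq_iff mult.commute)

lemma spectral_norm_le_iff:
  fixes M :: "real ^ 'n ^ 'n"
  assumes "\<mu> \<ge> 0"
  shows "spectral_norm M \<le> \<mu> \<longleftrightarrow> (\<forall>x. norm (M *v x) \<le> \<mu> * norm x)"
proof
  have bl: "bounded_linear ((*v) M)" by (simp add: matrix_vector_mul_bounded_linear)
  assume le: "spectral_norm M \<le> \<mu>"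
  show "\<forall>x. norm (M *v x) \<le> \<mu> * norm x"
  proof
    fix x
    have "norm (M *v x) \<le> spectral_norm M * norm x"
      unfolding spectral_norm_def by (rule onorm[OF bl])
    also have "\<dots> \<le> \<mu> * norm x" using le by (intro mult_right_mono) auto
    finally show "norm (M *v x) \<le> \<mu> * norm x" .
  qed
next
  assume "\<forall>x. norm (M *v x) \<le> \<mu> * norm x"
  then show "spectral_norm M \<le> \<mu>"
    unfolding spectral_norm_def using assms by (intro onorm_bound) auto
qed

text \<open>Polarization expresses \<open>x \<bullet> (M *v y)\<close> through the quadratic form at
  \<open>x + y\<close> and \<open>x - y\<close>; the parallelogram law then turns a bound on the
  form into a bound on the bilinear form.\<close>

lemma spectral_norm_le_iff_quadratic:
  fixes M :: "real ^ 'n ^ 'n"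
  assumes sym: "transpose M = M" and \<mu>: "\<mu> \<ge> 0"
  shows "spectral_norm M \<le> \<mu> \<longleftrightarrow> (\<forall>x. \<bar>x \<bullet> (M *v x)\<bar> \<le> \<mu> * (x \<bullet> x))"
  unfolding spectral_norm_le_iff[OF \<mu>]
proof
  assume *: "\<forall>x. norm (M *v x) \<le> \<mu> * norm x"
  show "\<forall>x. \<bar>x \<bullet> (M *v x)\<bar> \<le> \<mu> * (x \<bullet> x)"
  proof
    fix x
    have "\<bar>x \<bullet> (M *v x)\<bar> \<le> norm x * norm (M *v x)" by (rule Cauchy_Schwarz_ineq2)
    also have "\<dots> \<le> norm x * (\<mu> * norm x)" using * by (intro mult_left_mono) auto
    finally show "\<bar>x \<bullet> (M *v x)\<bar> \<le> \<mu> * (x \<bullet> x)"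
      by (simp add: dot_square_norm power2_eq_square algebra_simps)
  qed
next
  assume q: "\<forall>x. \<bar>x \<bullet> (M *v x)\<bar> \<le> \<mu> * (x \<bullet> x)"
  have symm: "x \<bullet> (M *v y) = y \<bullet> (M *v x)" for x y
    by (metis dot_lmul_matrix inner_commute sym transpose_matrix_vector)
  have bil: "2 * (x \<bullet> (M *v y)) \<le> \<mu> * (x \<bullet> x + y \<bullet> y)" for x y
  proof -
    have "4 * (x \<bullet> (M *v y)) = (x + y) \<bullet> (M *v (x + y)) - (x - y) \<bullet> (M *v (x - y))"
      using symm[of x y]
      by (simp add: matrix_vector_right_distrib matrix_vector_mult_diff_distrib inner_add_left
          inner_add_right inner_diff_left inner_diff_right)
    also have "\<dots> \<le> \<mu> * ((x + y) \<bullet> (x + y)) + \<mu> * ((x - y) \<bullet> (x - y))"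
      using q[rule_format, of "x + y"] q[rule_format, of "x - y"] by linarith
    also have "\<dots> = 2 * (\<mu> * (x \<bullet> x + y \<bullet> y))"
      by (simp add: inner_add_left inner_add_right inner_diff_left inner_diff_right
          inner_commute algebra_simps)
    finally show ?thesis by simp
  qed
  show "\<forall>x. norm (M *v x) \<le> \<mu> * norm x"
  proof
    fix x
    show "norm (M *v x) \<le> \<mu> * norm x"
    proof (cases "M *v x = 0")
      case True
      then show ?thesis using \<mu> by simp
    next
      case False
      then have n: "norm x > 0" "norm (M *v x) > 0" by auto
      \<comment> \<open>The direction of \<open>M *v x\<close> rescaled to the length of
        \<open>x\<close>: this makes \<open>w \<bullet> (M *v x)\<close> the product of the two
        norms and balances the two squares in \<open>bil\<close>.\<close>
      define w where "w = (norm x / norm (M *v x)) *\<^sub>R (M *v x)"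
      have "w \<bullet> (M *v x) = norm x * norm (M *v x)"
        using n by (simp add: w_def dot_square_norm power2_eq_square)
      moreover have "w \<bullet> w = (norm x)\<^sup>2"
        using n by (simp add: dot_square_norm w_def)
      ultimately have "2 * (norm x * norm (M *v x)) \<le> \<mu> * (2 * (norm x)\<^sup>2)"
        using bil[of w x] by (simp add: dot_square_norm)
      then have "norm x * norm (M *v x) \<le> norm x * (\<mu> * norm x)"
        by (simp add: power2_eq_square algebra_simps)
      then show ?thesis using n by simp
    qed
  qed
qed

subsection \<open>Rank-one approximation in an eigenbasis\<close>

locale eigenbasis =
  fixes A :: "real ^ 'n::finite ^ 'n" and lam :: "nat \<Rightarrow> real" and v :: "nat \<Rightarrow> real ^ 'n"
  assumes symmetric: "transpose A = A"
    and eigen: "j < CARD('n) \<Longrightarrow> A *v v j = lam j *\<^sub>R v j"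
    and orthonormal: "i < CARD('n) \<Longrightarrow> j < CARD('n) \<Longrightarrow> v i \<bullet> v j = (if i = j then 1 else 0)"
begin

text \<open>Orthonormal vectors are independent, and there are as many of them as the dimension, so
  they span the space.\<close>

lemma expand: "x = (\<Sum>j<CARD('n). (v j \<bullet> x) *\<^sub>R v j)"
proof -
  let ?B = "v ` {..<CARD('n)}"
  have inj: "inj_on v {..<CARD('n)}"
    by (rule inj_onI) (metis lessThan_iff orthonormal zero_neq_one)
  have norm: "norm b = 1" if "b \<in> ?B" for b
    using that orthonormal by (auto simp: norm_eq_1)
  have orth: "pairwise orthogonal ?B"
    using orthonormal by (auto simp: pairwise_def orthogonal_def)
  have "0 \<notin> ?B" using norm by fastforce
  then have "independent ?B" using orth pairwise_orthogonal_independent by blast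
  moreover have "card ?B = DIM(real ^ 'n)" using inj by (simp add: card_image)
  ultimately have "UNIV \<subseteq> span ?B"
    by (intro card_ge_dim_independent) (auto simp: dim_UNIV)
  then have "(\<Sum>b\<in>?B. (x \<bullet> b) *\<^sub>R b) = x"
    by (intro orthonormal_basis_expand[OF orth norm]) auto
  then show ?thesis using inj by (simp add: sum.reindex inner_commute)
qed

lemma parseval: "x \<bullet> y = (\<Sum>j<CARD('n). (v j \<bullet> x) * (v j \<bullet> y))"
  by (subst expand[of x]) (simp add: inner_sum_left)

lemma parseval_norm: "x \<bullet> x = (\<Sum>j<CARD('n). (v j \<bullet> x)\<^sup>2)"
  unfolding power2_eq_square by (rule parseval)

text \<open>Allows quantification over vectors to be replaced by quantification over arbitrary
  coordinate functions, the form in which the diagonal lemmas are stated.\<close>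

lemma coordinates_exist: "\<exists>w. \<forall>j<CARD('n). v j \<bullet> w = x j"
proof (intro exI allI impI)
  fix j assume "j < CARD('n)"
  then show "v j \<bullet> (\<Sum>i<CARD('n). x i *\<^sub>R v i) = x j"
    by (simp add: inner_sum_right orthonormal if_distrib cong: if_cong)
qed

lemma coordinate_mult: "j < CARD('n) \<Longrightarrow> v j \<bullet> (A *v x) = lam j * (v j \<bullet> x)"
  by (metis dot_lmul_matrix eigen inner_scaleR_left symmetric transpose_matrix_vector)

lemma coordinate_0_iff: "x = 0 \<longleftrightarrow> (\<forall>j<CARD('n). v j \<bullet> x = 0)"
  using expand[of x] by auto

lemma quadratic_form:
  "x \<bullet> ((A - c *\<^sub>R outer z) *v x) =
     (\<Sum>j<CARD('n). lam j * (v j \<bullet> x)\<^sup>2) - c * (\<Sum>j<CARD('n). (v j \<bullet> z) * (v j \<bullet> x))\<^sup>2"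
proof -
  have "x \<bullet> ((A - c *\<^sub>R outer z) *v x) = x \<bullet> (A *v x) - c * (z \<bullet> x)\<^sup>2"
    by (simp add: matrix_vector_mult_diff_rdistrib scaleR_matrix_vector_assoc[symmetric]
        outer_mult_vec inner_diff_right inner_commute power2_eq_square)
  also have "x \<bullet> (A *v x) = (\<Sum>j<CARD('n). lam j * (v j \<bullet> x)\<^sup>2)"
    unfolding parseval[of x "A *v x"]
    by (auto simp: coordinate_mult power2_eq_square intro!: sum.cong)
  finally show ?thesis by (simp add: parseval[of z x])
qed

text \<open>In eigencoordinates the shifted matrix multiplies by \<open>lam j - \<mu>\<close>, so
  its kernel is trivial and its inverse divides by these numbers. This links the two formulas for
  the optimal factor in part (2).\<close>

lemma shifted_resolvent:
  assumes "\<And>j. j < CARD('n) \<Longrightarrow> lam j \<noteq> \<mu>"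
  shows "invertible (A - \<mu> *\<^sub>R mat 1)"
    and "z \<bullet> (matrix_inv (A - \<mu> *\<^sub>R mat 1) *v z) = (\<Sum>j<CARD('n). (v j \<bullet> z)\<^sup>2 / (lam j - \<mu>))"
proof -
  let ?M = "A - \<mu> *\<^sub>R mat 1"
  have coord: "v j \<bullet> (?M *v x) = (lam j - \<mu>) * (v j \<bullet> x)" if "j < CARD('n)" for j x
    using that by (simp add: matrix_vector_mult_diff_rdistrib scaleR_matrix_vector_assoc[symmetric]
        inner_diff_right coordinate_mult algebra_simps)
  have "x = 0" if "?M *v x = 0" for x
  proof -
    have "(lam j - \<mu>) * (v j \<bullet> x) = 0" if "j < CARD('n)" for j
      using coord[OF that, of x] \<open>?M *v x = 0\<close> by simp
    then show ?thesis using assms by (auto simp: coordinate_0_iff)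
  qed
  then show inv: "invertible ?M"
    by (simp add: invertible_left_inverse matrix_left_invertible_ker)
  let ?y = "matrix_inv ?M *v z"
  have "?M *v ?y = z"
    using inv unfolding invertible_def matrix_inv_def
    by (metis (mono_tags, lifting) matrix_vector_mul_assoc matrix_vector_mul_lid someI_ex)
  then have "v j \<bullet> ?y = (v j \<bullet> z) / (lam j - \<mu>)" if "j < CARD('n)" for j
    using coord[OF that, of ?y] assms[OF that] by (simp add: field_simps)
  then show "z \<bullet> ?y = (\<Sum>j<CARD('n). (v j \<bullet> z)\<^sup>2 / (lam j - \<mu>))"
    unfolding parseval[of z ?y]
    by (auto simp: power2_eq_square intro!: sum.cong)
qed

end

section \<open>Rank-one error bounds when the largest eigenvalue is separated from the
  others\<close>

locale dominant_eigenbasis = eigenbasis A lam v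
  for A :: "real ^ 'n::finite ^ 'n" and lam v +
  assumes N_ge_2: "CARD('n) \<ge> 2"
    and ordered: "i \<le> j \<Longrightarrow> j < CARD('n) \<Longrightarrow> \<bar>lam j\<bar> \<le> \<bar>lam i\<bar>"
    and gap: "lam 0 > \<bar>lam 1\<bar>"
begin

lemma lessThan_N: "{..<CARD('n)} = insert 0 {1..<CARD('n)}"
  using N_ge_2 by auto

lemma abs_lam_le: "1 \<le> j \<Longrightarrow> j < CARD('n) \<Longrightarrow> \<bar>lam j\<bar> \<le> \<bar>lam 1\<bar>"
  by (rule ordered)

text \<open>Strictly between \<open>|lam 1|\<close> and \<open>lam 0\<close> the orthogonality
  condition is vacuous and f has no poles.\<close>

lemma abs_lam_neq:
  assumes "\<bar>lam 1\<bar> < \<mu>" "\<mu> < lam 0" "j < CARD('n)" shows "\<bar>lam j\<bar> \<noteq> \<mu>"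
  using abs_lam_le[of j] assms by (cases "j = 0") auto

text \<open>If \<open>lam 1 = 0\<close>, the ordering kills all later eigenvalues and the range of
  \<open>A\<close> lies in the line spanned by \<open>v 0\<close>.\<close>

lemma lam1_nonzero:
  assumes "rank A > 1" shows "lam 1 \<noteq> 0"
proof
  assume "lam 1 = 0"
  then have zero: "lam j = 0" if "j \<in> {1..<CARD('n)}" for j
    using abs_lam_le[of j] that by simp
  have "A *v x \<in> span {v 0}" for x
  proof -
    have "A *v x = (\<Sum>j<CARD('n). (lam j * (v j \<bullet> x)) *\<^sub>R v j)"
      by (subst expand[of "A *v x"]) (simp add: coordinate_mult)
    also have "\<dots> = (lam 0 * (v 0 \<bullet> x)) *\<^sub>R v 0"
      by (simp add: lessThan_N zero)
    finally show ?thesis by (simp add: span_mul span_base)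
  qed
  then have "rank A \<le> card {v 0}"
    unfolding rank_dim_range by (intro dim_le_card) auto
  with assms show False by simp
qed

text \<open>The plane spanned by \<open>v 0\<close> and \<open>v 1\<close> contains a nonzero vector
  orthogonal to \<open>z\<close>. The rank-one term vanishes on it, and \<open>A\<close> stretches
  it by at least \<open>|lam 1|\<close>.\<close>

lemma abs_lam1_le_spectral_norm: "\<bar>lam 1\<bar> \<le> spectral_norm (A - c *\<^sub>R outer z)"
proof -
  let ?M = "A - c *\<^sub>R outer z"
  have N: "0 < CARD('n)" "1 < CARD('n)" using N_ge_2 by auto
  obtain p q :: real where pq: "p * (v 0 \<bullet> z) + q * (v 1 \<bullet> z) = 0" "p\<^sup>2 + q\<^sup>2 > 0"
  proof (cases "v 0 \<bullet> z = 0 \<and> v 1 \<bullet> z = 0")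
    case True
    then show ?thesis using that[of 1 0] by simp
  next
    case False
    then show ?thesis using that[of "v 1 \<bullet> z" "- (v 0 \<bullet> z)"]
      by (simp add: sum_power2_gt_zero_iff algebra_simps)
  qed
  define x where "x = p *\<^sub>R v 0 + q *\<^sub>R v 1"
  have norm2: "(norm (r *\<^sub>R v 0 + s *\<^sub>R v 1))\<^sup>2 = r\<^sup>2 + s\<^sup>2" for r s
    unfolding power2_norm_eq_inner using orthonormal N
    by (simp add: inner_add_left inner_add_right power2_eq_square)
  have "z \<bullet> x = 0" using pq(1) by (simp add: x_def inner_add_right inner_commute)
  then have Mx: "?M *v x = (p * lam 0) *\<^sub>R v 0 + (q * lam 1) *\<^sub>R v 1"
    using eigen N
    by (simp add: matrix_vector_mult_diff_rdistrib scaleR_matrix_vector_assoc[symmetric]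
        outer_mult_vec) (simp add: x_def matrix_vector_right_distrib matrix_vector_mult_scaleR)
  have "(\<bar>lam 1\<bar> * norm x)\<^sup>2 = (lam 1)\<^sup>2 * p\<^sup>2 + (lam 1)\<^sup>2 * q\<^sup>2"
    unfolding x_def power_mult_distrib norm2 by (simp add: algebra_simps)
  also have "\<dots> \<le> (lam 0)\<^sup>2 * p\<^sup>2 + (lam 1)\<^sup>2 * q\<^sup>2"
    using gap by (intro add_right_mono mult_right_mono) (auto simp: abs_le_square_iff[symmetric])
  also have "\<dots> = (norm (?M *v x))\<^sup>2"
    unfolding Mx norm2 by (simp add: power_mult_distrib algebra_simps)
  finally have "\<bar>lam 1\<bar> * norm x \<le> norm (?M *v x)"
    by (rule power2_le_imp_le) simp
  also have "\<dots> \<le> spectral_norm ?M * norm x"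
    unfolding spectral_norm_def by (intro onorm matrix_vector_mul_bounded_linear)
  finally have "\<bar>lam 1\<bar> * norm x \<le> spectral_norm ?M * norm x" .
  moreover have "norm x > 0" using pq(2) norm2[of p q] by (auto simp: x_def)
  ultimately show ?thesis by simp
qed

lemma spectral_norm_le_iff_bounds:
  assumes \<mu>: "\<bar>lam 1\<bar> \<le> \<mu>" "\<mu> < lam 0"
  shows "spectral_norm (A - c *\<^sub>R outer z) \<le> \<mu> \<longleftrightarrow>
    c > 0 \<and> (\<forall>j<CARD('n). \<bar>lam j\<bar> = \<mu> \<longrightarrow> v j \<bullet> z = 0) \<and>
    (\<Sum>j<CARD('n). (v j \<bullet> z)\<^sup>2 / (lam j + \<mu>)) \<le> 1 / c \<and>
    1 / c \<le> (\<Sum>j<CARD('n). (v j \<bullet> z)\<^sup>2 / (lam j - \<mu>))"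
proof -
  let ?M = "A - c *\<^sub>R outer z" and ?J = "{1..<CARD('n)}" and ?N = "{..<CARD('n)}"
  let ?a = "\<lambda>j. v j \<bullet> z"
  \<comment> \<open>In eigencoordinates, \<open>?above\<close> and \<open>?below\<close> say that
    the forms of \<open>\<mu> I - ?M\<close> and \<open>\<mu> I + ?M\<close> are nonnegative. Index
    0 is split off in \<open>?above\<close> since only there \<open>\<mu> - lam j\<close> is
    negative.\<close>
  let ?above = "\<forall>x. (lam 0 - \<mu>) * (x 0)\<^sup>2 \<le>
    (\<Sum>j\<in>?J. (\<mu> - lam j) * (x j)\<^sup>2) + c * (?a 0 * x 0 + (\<Sum>j\<in>?J. ?a j * x j))\<^sup>2"
  let ?below = "\<forall>x. c * (\<Sum>j\<in>?N. ?a j * x j)\<^sup>2 \<le> (\<Sum>j\<in>?N. (lam j + \<mu>) * (x j)\<^sup>2)"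
  let ?coord = "\<lambda>x. \<bar>(\<Sum>j\<in>?N. lam j * (x j)\<^sup>2) - c * (\<Sum>j\<in>?N. ?a j * x j)\<^sup>2\<bar> \<le>
    \<mu> * (\<Sum>j\<in>?N. (x j)\<^sup>2)"
  have "transpose ?M = ?M"
    using symmetric transpose_outer[of z] by (simp add: transpose_def vec_eq_iff)
  then have "spectral_norm ?M \<le> \<mu> \<longleftrightarrow> (\<forall>x. ?coord (\<lambda>j. v j \<bullet> x))"
    using \<mu> spectral_norm_le_iff_quadratic[of ?M \<mu>]
    by (simp only:  quadratic_form parseval_norm)
  \<comment> \<open>Every assignment of coordinates below N is realized by a vector, and values at
    other indices do not enter the sums.\<close>
  also have "\<dots> \<longleftrightarrow> (\<forall>x. ?coord x)"
  proof (intro iffI allI)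
    fix x :: "nat \<Rightarrow> real"
    assume *: "\<forall>x. ?coord (\<lambda>j. v j \<bullet> x)"
    obtain w where w: "\<forall>j<CARD('n). v j \<bullet> w = x j" using coordinates_exist by blast
    show "?coord x" using *[rule_format, of w] w by simp
  qed auto
  also have "\<dots> \<longleftrightarrow> (\<forall>x.
      (lam 0 - \<mu>) * (x 0)\<^sup>2 \<le>
        (\<Sum>j\<in>?J. (\<mu> - lam j) * (x j)\<^sup>2) + c * (?a 0 * x 0 + (\<Sum>j\<in>?J. ?a j * x j))\<^sup>2 \<and>
      c * (\<Sum>j\<in>?N. ?a j * x j)\<^sup>2 \<le> (\<Sum>j\<in>?N. (lam j + \<mu>) * (x j)\<^sup>2))"
  proof (intro arg_cong[where f = All] ext)
    fix x :: "nat \<Rightarrow> real"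
    have "(\<Sum>j\<in>?N. (lam j + \<mu>) * (x j)\<^sup>2) =
        (\<Sum>j\<in>?N. lam j * (x j)\<^sup>2) + \<mu> * (\<Sum>j\<in>?N. (x j)\<^sup>2)"
      by (simp add: algebra_simps sum.distrib sum_distrib_left)
    moreover have "(\<Sum>j\<in>?J. (\<mu> - lam j) * (x j)\<^sup>2) - (lam 0 - \<mu>) * (x 0)\<^sup>2 =
        \<mu> * (\<Sum>j\<in>?N. (x j)\<^sup>2) - (\<Sum>j\<in>?N. lam j * (x j)\<^sup>2)"
      by (simp add: lessThan_N algebra_simps sum_subtractf sum_distrib_left)
    moreover have "?a 0 * x 0 + (\<Sum>j\<in>?J. ?a j * x j) = (\<Sum>j\<in>?N. ?a j * x j)"
      by (simp add: lessThan_N)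
    ultimately show "?coord x \<longleftrightarrow>
      (lam 0 - \<mu>) * (x 0)\<^sup>2 \<le>
        (\<Sum>j\<in>?J. (\<mu> - lam j) * (x j)\<^sup>2) + c * (?a 0 * x 0 + (\<Sum>j\<in>?J. ?a j * x j))\<^sup>2 \<and>
      c * (\<Sum>j\<in>?N. ?a j * x j)\<^sup>2 \<le> (\<Sum>j\<in>?N. (lam j + \<mu>) * (x j)\<^sup>2)"
      by (simp only: abs_le_iff distrib_left distrib_right) argo
  qed
  also have "\<dots> \<longleftrightarrow> ?above \<and> ?below" by blast
  also have "?above \<longleftrightarrow> c > 0 \<and> (\<forall>j\<in>?J. \<mu> - lam j = 0 \<longrightarrow> ?a j = 0) \<and>
      (\<Sum>j\<in>?J. (?a j)\<^sup>2 / (\<mu> - lam j)) + 1 / c \<le> (?a 0)\<^sup>2 / (lam 0 - \<mu>)"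
    using \<mu> abs_lam_le
    by (intro rank_one_lifts_negative_square_iff) (auto, fastforce)
  also have "(\<Sum>j\<in>?J. (?a j)\<^sup>2 / (\<mu> - lam j)) + 1 / c \<le> (?a 0)\<^sup>2 / (lam 0 - \<mu>) \<longleftrightarrow>
      1 / c \<le> (\<Sum>j\<in>?N. (?a j)\<^sup>2 / (lam j - \<mu>))"
  proof -
    have "(\<Sum>j\<in>?J. (?a j)\<^sup>2 / (\<mu> - lam j)) = - (\<Sum>j\<in>?J. (?a j)\<^sup>2 / (lam j - \<mu>))"
      by (simp add: sum_negf[symmetric]) (metis minus_diff_eq minus_divide_right)
    then show ?thesis by (simp add: lessThan_N) linarith
  qed
  finally have eq: "spectral_norm ?M \<le> \<mu> \<longleftrightarrow> (c > 0 \<and> (\<forall>j\<in>?J. \<mu> - lam j = 0 \<longrightarrow> ?a j = 0) \<and>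
      1 / c \<le> (\<Sum>j\<in>?N. (?a j)\<^sup>2 / (lam j - \<mu>))) \<and> ?below" .
  \<comment> \<open>The criterion for \<open>?below\<close> presupposes a positive \<open>c\<close>,
    which \<open>?above\<close> has already supplied.\<close>
  have below: "?below \<longleftrightarrow> (\<forall>j\<in>?N. lam j + \<mu> = 0 \<longrightarrow> ?a j = 0) \<and>
      (\<Sum>j\<in>?N. (?a j)\<^sup>2 / (lam j + \<mu>)) \<le> 1 / c" if "c > 0"
  proof (rule diagonal_dominates_rank_one_iff[OF _ _ that])
    fix j assume "j \<in> ?N"
    then show "lam j + \<mu> \<ge> 0"
      using \<mu> gap abs_lam_le[of j] by (cases "j = 0") auto
  qed simp
  \<comment> \<open>The two forms degenerate at \<open>lam j = \<mu>\<close> and at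
    \<open>lam j = - \<mu>\<close> respectively; together these are the indices with
    \<open>|lam j| = \<mu>\<close>, and \<open>\<mu> < lam 0\<close> excludes index 0.\<close>
  have "(\<forall>j<CARD('n). \<bar>lam j\<bar> = \<mu> \<longrightarrow> ?a j = 0) \<longleftrightarrow>
      (\<forall>j\<in>?J. \<mu> - lam j = 0 \<longrightarrow> ?a j = 0) \<and> (\<forall>j\<in>?N. lam j + \<mu> = 0 \<longrightarrow> ?a j = 0)"
  proof (intro iffI allI impI)
    fix j
    assume *: "(\<forall>j\<in>?J. \<mu> - lam j = 0 \<longrightarrow> ?a j = 0) \<and> (\<forall>j\<in>?N. lam j + \<mu> = 0 \<longrightarrow> ?a j = 0)"
      and j: "j < CARD('n)" "\<bar>lam j\<bar> = \<mu>"
    have "j \<noteq> 0" using j \<mu> by (cases "j = 0") auto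
    with * j show "?a j = 0" by (cases "lam j \<ge> 0") auto
  next
    assume *: "\<forall>j<CARD('n). \<bar>lam j\<bar> = \<mu> \<longrightarrow> ?a j = 0"
    have "\<mu> \<ge> 0" using \<mu> by simp
    show "(\<forall>j\<in>?J. \<mu> - lam j = 0 \<longrightarrow> ?a j = 0) \<and> (\<forall>j\<in>?N. lam j + \<mu> = 0 \<longrightarrow> ?a j = 0)"
    proof (intro conjI ballI impI)
      fix j assume "j \<in> ?J" "\<mu> - lam j = 0"
      with * \<open>\<mu> \<ge> 0\<close> show "?a j = 0" by simp
    next
      fix j assume "j \<in> ?N" "lam j + \<mu> = 0"
      with * \<open>\<mu> \<ge> 0\<close> show "?a j = 0" by (metis abs_minus_cancel abs_of_nonneg add_eq_0_iff lessThan_iff)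
    qed
  qed
  with eq below show ?thesis by blast
qed

text \<open>Partial fractions term by term; at a pole the numerator is zero, so both sides
  vanish.\<close>

lemma sum_minus_diff_sum_plus:
  assumes "\<And>j. j < CARD('n) \<Longrightarrow> \<bar>lam j\<bar> = \<mu> \<Longrightarrow> v j \<bullet> z = 0" "\<mu> \<ge> 0"
  shows "(\<Sum>j<CARD('n). (v j \<bullet> z)\<^sup>2 / (lam j - \<mu>)) - (\<Sum>j<CARD('n). (v j \<bullet> z)\<^sup>2 / (lam j + \<mu>)) =
    2 * \<mu> * (\<Sum>j<CARD('n). (v j \<bullet> z)\<^sup>2 / ((lam j)\<^sup>2 - \<mu>\<^sup>2))"
  unfolding sum_subtractf[symmetric] sum_distrib_left
proof (intro sum.cong refl)
  fix j assume j: "j \<in> {..<CARD('n)}"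
  show "(v j \<bullet> z)\<^sup>2 / (lam j - \<mu>) - (v j \<bullet> z)\<^sup>2 / (lam j + \<mu>) =
      2 * \<mu> * ((v j \<bullet> z)\<^sup>2 / ((lam j)\<^sup>2 - \<mu>\<^sup>2))"
  proof (cases "\<bar>lam j\<bar> = \<mu>")
    case True
    then show ?thesis using assms j by simp
  next
    case False
    then have "lam j - \<mu> \<noteq> 0" "lam j + \<mu> \<noteq> 0" using \<open>\<mu> \<ge> 0\<close> by linarith+
    moreover have "(lam j)\<^sup>2 - \<mu>\<^sup>2 = (lam j - \<mu>) * (lam j + \<mu>)"
      by (simp add: power2_eq_square algebra_simps)
    ultimately show ?thesis by (simp add: divide_simps) (simp add: algebra_simps)
  qed
qed

text \<open>An admissible \<open>1 / c\<close> exists exactly when the interval from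
  \<open>?T\<close> to \<open>?S\<close> is nonempty, since \<open>z \<noteq> 0\<close> makes
  \<open>?T\<close> positive. Its length is \<open>2 * \<mu> * ?F\<close>, so the sign of
  \<open>?F\<close> decides.\<close>

lemma exists_scaling_iff:
  assumes \<mu>: "\<bar>lam 1\<bar> \<le> \<mu>" "\<mu> < lam 0" "\<mu> > 0" and "z \<noteq> 0"
  shows "(\<exists>c. spectral_norm (A - c *\<^sub>R outer z) \<le> \<mu>) \<longleftrightarrow>
    (\<forall>j<CARD('n). \<bar>lam j\<bar> = \<mu> \<longrightarrow> v j \<bullet> z = 0) \<and>
    (\<Sum>j<CARD('n). (v j \<bullet> z)\<^sup>2 / ((lam j)\<^sup>2 - \<mu>\<^sup>2)) \<ge> 0" (is "?L \<longleftrightarrow> ?zero \<and> ?F \<ge> 0")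
proof -
  let ?S = "\<Sum>j<CARD('n). (v j \<bullet> z)\<^sup>2 / (lam j - \<mu>)"
  let ?T = "\<Sum>j<CARD('n). (v j \<bullet> z)\<^sup>2 / (lam j + \<mu>)"
  have F: "?F \<ge> 0 \<longleftrightarrow> ?T \<le> ?S" if ?zero
  proof -
    have "?S - ?T = 2 * \<mu> * ?F" using that \<mu> by (intro sum_minus_diff_sum_plus) auto
    then show ?thesis using \<open>\<mu> > 0\<close> by (smt (verit) mult_nonneg_nonneg mult_pos_neg)
  qed
  have T: "?T > 0" if ?zero
  proof -
    obtain j where "j < CARD('n)" "v j \<bullet> z \<noteq> 0" using \<open>z \<noteq> 0\<close> coordinate_0_iff by blast
    have ge: "lam i + \<mu> \<ge> 0" if "i < CARD('n)" for i
      using \<mu> abs_lam_le[of i] that by (cases "i = 0") auto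
    have "\<bar>lam j\<bar> \<noteq> \<mu>" using \<open>?zero\<close> \<open>j < CARD('n)\<close> \<open>v j \<bullet> z \<noteq> 0\<close> by blast
    then have "lam j + \<mu> > 0" using ge[of j] \<open>j < CARD('n)\<close> \<mu> by linarith
    then have "0 < (v j \<bullet> z)\<^sup>2 / (lam j + \<mu>)" using \<open>v j \<bullet> z \<noteq> 0\<close> by simp
    then show ?thesis
      using \<open>j < CARD('n)\<close> ge by (intro sum_pos2[of _ j]) auto
  qed
  show ?thesis
  proof
    assume ?L
    then show "?zero \<and> ?F \<ge> 0"
      using F unfolding spectral_norm_le_iff_bounds[OF \<mu>(1,2)] by fastforce
  next
    assume *: "?zero \<and> ?F \<ge> 0"
    then have "?T > 0" "?T \<le> ?S" using T F by auto
    \<comment> \<open>The choice \<open>c = 1 / ?S\<close> places \<open>1 / c\<close> at the upper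
      end of the interval.\<close>
    then have "spectral_norm (A - (1 / ?S) *\<^sub>R outer z) \<le> \<mu>"
      unfolding spectral_norm_le_iff_bounds[OF \<mu>(1,2)] using * by auto
    then show ?L by blast
  qed
qed

end

subsection \<open>Rank-one Hankel approximation\<close>

lemma hankel1_eq_outer: "hankel1 c z = c *\<^sub>R outer (zvec z)"
  by (simp add: hankel1_def outer_def)

text \<open>Since \<open>0 / 0 = 0\<close> in HOL, the omitted terms contribute nothing to the full
  sum.\<close>

lemma sum_primed_eq_sum: "finite J \<Longrightarrow> sum_primed a b J = (\<Sum>j\<in>J. a j / b j)"
  unfolding sum_primed_def by (intro sum.mono_neutral_left) auto

lemma inj_pos: "inj (pos :: 'n::{finite,linorder} \<Rightarrow> nat)"
proof (rule strict_mono_imp_inj_on, rule strict_monoI)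
  fix i j :: 'n
  assume "i < j"
  then have "{k. k < i} \<subset> {k. k < j}" by auto
  then show "pos i < pos j" unfolding pos_def by (intro psubset_card_mono) auto
qed

lemma sum_even_powers_pos: "(\<Sum>k<CARD('n::finite). z ^ (2 * k)) > (0::real)"
  by (rule sum_pos2[of _ 0]) auto

lemma zvec_nonzero: "zvec z \<noteq> (0 :: real ^ 'n::{finite,linorder})"
proof (cases z)
  case (Fin t)
  have "\<not> j < Min (UNIV :: 'n set)" for j by (metis Min_le UNIV_I finite leD)
  then have "pos (Min UNIV :: 'n) = 0" by (simp only: pos_def) simp
  then have "zvec z $ (Min UNIV :: 'n) = 1 / sqrt (\<Sum>k<CARD('n). t ^ (2 * k))"
    by (simp add: Fin)
  then have "zvec z $ (Min UNIV :: 'n) > 0"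
    using sum_even_powers_pos[of t, where 'n = 'n] by simp
  then show ?thesis by (metis less_irrefl zero_index)
next
  case Infty
  then show ?thesis by (simp add: axis_eq_0_iff)
qed

text \<open>A vector orthogonal to every \<open>zvec (Fin t)\<close> is the coefficient vector of a
  polynomial vanishing at all real \<open>t\<close>, hence zero.\<close>

lemma zvec_not_in_hyperplane:
  fixes w :: "real ^ 'n::{finite,linorder}"
  assumes "w \<noteq> 0"
  shows "\<exists>z. w \<bullet> zvec z \<noteq> 0"
proof (rule ccontr)
  assume "\<nexists>z. w \<bullet> zvec z \<noteq> 0"
  then have zero: "w \<bullet> zvec (Fin t) = 0" for t by blast
  obtain i where i: "w $ i \<noteq> 0" using assms by (auto simp: vec_eq_iff)
  let ?R = "range (pos :: 'n \<Rightarrow> nat)" and ?p = "the_inv (pos :: 'n \<Rightarrow> nat)"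
  \<comment> \<open>Coefficients indexed by exponents and extended by 0 outside the range of
    \<open>pos\<close>, so that injectivity of \<open>pos\<close> suffices.\<close>
  define c where "c k = (if k \<in> ?R then w $ ?p k else 0)" for k
  have "(\<Sum>k\<le>Max ?R. c k * t ^ k) = 0" for t
  proof -
    have "(\<Sum>k\<le>Max ?R. c k * t ^ k) = (\<Sum>k\<in>?R. c k * t ^ k)"
      by (intro sum.mono_neutral_right) (auto simp: c_def)
    also have "\<dots> = (\<Sum>i\<in>UNIV. w $ i * t ^ pos i)"
      by (simp add: sum.reindex[OF inj_pos] c_def the_inv_f_f[OF inj_pos])
    also have "\<dots> = 0"
      using zero[of t] sum_even_powers_pos[of t, where 'n = 'n] 
      by (simp add: inner_vec_def sum_divide_distrib[symmetric])
    finally show ?thesis .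
  qed
  then have "c (pos i) = 0"
    using polyfun_eq_0[of c "Max ?R"] by simp
  then show False using i by (simp add: c_def the_inv_f_f[OF inj_pos])
qed

locale dominant_hankel = dominant_eigenbasis A lam v
  for A :: "real ^ 'n::{finite,linorder} ^ 'n::{finite,linorder}" and lam v +
  assumes rank_gt_1: "rank A > 1"
begin

lemma abs_lam1_pos: "\<bar>lam 1\<bar> > 0"
  using lam1_nonzero[OF rank_gt_1] by simp

lemma ffun_eq: "ffun lam v z s = (\<Sum>j<CARD('n). (v j \<bullet> zvec z)\<^sup>2 / ((lam j)\<^sup>2 - s))"
  by (simp add: ffun_def sum_primed_eq_sum)

lemma hankel1_error_ge: "\<bar>lam 1\<bar> \<le> spectral_norm (A - hankel1 c z)"
  unfolding hankel1_eq_outer by (rule abs_lam1_le_spectral_norm)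

text \<open>As \<open>|lam 1|\<close> bounds every error from below, attaining it is the same as not
  exceeding it; this is the form in which the norm criteria apply.\<close>

lemma hankel1_error_squared_eq_iff:
  "(spectral_norm (A - hankel1 c z))\<^sup>2 = (lam 1)\<^sup>2 \<longleftrightarrow> spectral_norm (A - hankel1 c z) \<le> \<bar>lam 1\<bar>"
  using hankel1_error_ge[of c z] by (auto simp: power2_eq_iff)

lemma exists_hankel1_error_le_lam1_iff:
  "(\<exists>c. spectral_norm (A - hankel1 c z) \<le> \<bar>lam 1\<bar>) \<longleftrightarrow> cond_i lam v z"
  unfolding hankel1_eq_outer cond_i_def ffun_eq
  using exists_scaling_iff[of "\<bar>lam 1\<bar>" "zvec z"] gap abs_lam1_pos
  by (simp add: zvec_nonzero)

text \<open>The general bounds at \<open>\<mu> = |lam 1|\<close> demand \<open>c > 0\<close>. Here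
  \<open>c \<noteq> 0\<close> is enough, because the lower bound in \<open>cond_ii\<close> is
  nonnegative and so fixes the sign of \<open>c\<close>.\<close>

lemma hankel1_error_le_lam1_iff:
  "spectral_norm (A - hankel1 c z) \<le> \<bar>lam 1\<bar> \<longleftrightarrow> c \<noteq> 0 \<and> cond_i lam v z \<and> cond_ii lam v z c"
proof -
  let ?zero = "\<forall>j<CARD('n). \<bar>lam j\<bar> = \<bar>lam 1\<bar> \<longrightarrow> v j \<bullet> zvec z = 0"
  let ?S = "\<Sum>j<CARD('n). (v j \<bullet> zvec z)\<^sup>2 / (lam j - \<bar>lam 1\<bar>)"
  let ?T = "\<Sum>j<CARD('n). (v j \<bullet> zvec z)\<^sup>2 / (lam j + \<bar>lam 1\<bar>)"
  have bounds: "spectral_norm (A - hankel1 c z) \<le> \<bar>lam 1\<bar> \<longleftrightarrow>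
      c > 0 \<and> ?zero \<and> ?T \<le> 1 / c \<and> 1 / c \<le> ?S"
    unfolding hankel1_eq_outer using gap by (intro spectral_norm_le_iff_bounds) auto
  have pos: "c > 0" if "c \<noteq> 0" ?zero "?T \<le> 1 / c"
  proof -
    have "?T \<ge> 0"
    proof (intro sum_nonneg divide_nonneg_nonneg)
      fix j assume "j \<in> {..<CARD('n)}"
      then show "lam j + \<bar>lam 1\<bar> \<ge> 0"
        using abs_lam_le[of j] gap by (cases "j = 0") auto
    qed simp
    then have "1 / c \<ge> 0" using that by linarith
    then show ?thesis using \<open>c \<noteq> 0\<close> by simp
  qed
  have cond_ii: "cond_ii lam v z c \<longleftrightarrow> ?T \<le> 1 / c \<and> 1 / c \<le> ?S"
    by (simp add: cond_ii_def sum_primed_eq_sum)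
  show ?thesis
  proof
    assume le: "spectral_norm (A - hankel1 c z) \<le> \<bar>lam 1\<bar>"
    then have "cond_i lam v z" using exists_hankel1_error_le_lam1_iff by blast
    then show "c \<noteq> 0 \<and> cond_i lam v z \<and> cond_ii lam v z c"
      using le unfolding bounds cond_ii by auto
  next
    assume *: "c \<noteq> 0 \<and> cond_i lam v z \<and> cond_ii lam v z c"
    then have zero: ?zero by (simp add: cond_i_def)
    with * pos show "spectral_norm (A - hankel1 c z) \<le> \<bar>lam 1\<bar>"
      unfolding bounds cond_ii by blast
  qed
qed

lemma exists_hankel1_error_le_iff:
  assumes "\<bar>lam 1\<bar> < \<mu>" "\<mu> < lam 0"
  shows "(\<exists>c. spectral_norm (A - hankel1 c z) \<le> \<mu>) \<longleftrightarrow> ffun lam v z (\<mu>\<^sup>2) \<ge> 0"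
  unfolding hankel1_eq_outer ffun_eq
  using exists_scaling_iff[of \<mu> "zvec z"] abs_lam_neq[of \<mu>] assms
  by (auto simp: zvec_nonzero)

section \<open>Optimal errors strictly between \<open>|lam 1|\<close> and
  \<open>lam 0\<close>\<close>

lemma isCont_ffun:
  assumes "\<bar>lam 1\<bar> < \<mu>" "\<mu> < lam 0"
  shows "isCont (\<lambda>\<mu>. ffun lam v z (\<mu>\<^sup>2)) \<mu>"
proof -
  have "(lam j)\<^sup>2 - \<mu>\<^sup>2 \<noteq> 0" if "j < CARD('n)" for j
    using abs_lam_neq[OF assms that] assms by (auto simp: power2_eq_iff)
  then show ?thesis unfolding ffun_eq by (intro continuous_intros) auto
qed

text \<open>By continuity f stays positive slightly to the left of \<open>\<mu>\<close>, where
  nonnegativity already yields an approximation. Hence f cannot be positive anywhere at the optimal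
  error.\<close>

lemma exists_smaller_error:
  assumes \<mu>: "\<bar>lam 1\<bar> < \<mu>" "\<mu> < lam 0" and pos: "ffun lam v z (\<mu>\<^sup>2) > 0"
  shows "\<exists>c. spectral_norm (A - hankel1 c z) < \<mu>"
proof -
  have "((\<lambda>\<mu>. ffun lam v z (\<mu>\<^sup>2)) \<longlongrightarrow> ffun lam v z (\<mu>\<^sup>2)) (at_left \<mu>)"
    using isCont_ffun[OF \<mu>, of z] by (simp add: isCont_def filterlim_at_split)
  then have "\<forall>\<^sub>F \<nu> in at_left \<mu>. ffun lam v z (\<nu>\<^sup>2) > 0"
    using pos by (rule order_tendstoD)
  moreover have "\<forall>\<^sub>F \<nu> in at_left \<mu>. \<nu> \<in> {\<bar>lam 1\<bar><..<\<mu>}"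
    using \<mu> by (intro eventually_at_left_real) simp
  ultimately have "\<forall>\<^sub>F \<nu> in at_left \<mu>. ffun lam v z (\<nu>\<^sup>2) > 0 \<and> \<nu> \<in> {\<bar>lam 1\<bar><..<\<mu>}"
    by (rule eventually_conj)
  then obtain \<nu> where \<nu>: "ffun lam v z (\<nu>\<^sup>2) > 0" "\<bar>lam 1\<bar> < \<nu>" "\<nu> < \<mu>"
    using eventually_happens'[OF trivial_limit_at_left_real] by auto
  then obtain c where "spectral_norm (A - hankel1 c z) \<le> \<nu>"
    using exists_hankel1_error_le_iff[of \<nu> z] \<mu> by auto
  then show ?thesis using \<nu> by (intro exI[of _ c]) simp
qed

text \<open>For \<open>z\<close> with \<open>v 0 \<bullet> zvec z \<noteq> 0\<close>, the term of
  index 0 drives f to plus infinity as \<open>\<mu>\<close> approaches \<open>lam 0\<close> from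
  below, so f becomes nonnegative before \<open>lam 0\<close> is reached.\<close>

lemma exists_error_less_lam0: "\<exists>c z. spectral_norm (A - hankel1 c z) < lam 0"
proof -
  have "v 0 \<noteq> 0" using orthonormal[of 0 0] by auto
  then obtain z where z: "v 0 \<bullet> zvec z \<noteq> 0" using zvec_not_in_hyperplane by blast
  let ?J = "{1..<CARD('n)}" and ?a = "\<lambda>j. (v j \<bullet> zvec z)\<^sup>2"
  \<comment> \<open>The function \<open>f(z, \<cdot>)\<close> with its pole at \<open>lam 0\<close> cleared.\<close>
  define g where "g \<mu> = ?a 0 + ((lam 0)\<^sup>2 - \<mu>\<^sup>2) * (\<Sum>j\<in>?J. ?a j / ((lam j)\<^sup>2 - \<mu>\<^sup>2))" for \<mu>
  have "(lam j)\<^sup>2 - (lam 0)\<^sup>2 \<noteq> 0" if "j \<in> ?J" for j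
    using abs_lam_le[of j] gap that by (auto simp: power2_eq_iff)
  then have "isCont g (lam 0)"
    unfolding g_def by (intro continuous_intros) auto
  then have "(g \<longlongrightarrow> g (lam 0)) (at_left (lam 0))"
    by (simp add: isCont_def filterlim_at_split)
  moreover have "g (lam 0) > 0" using z by (simp add: g_def)
  ultimately have "\<forall>\<^sub>F \<mu> in at_left (lam 0). g \<mu> > 0" by (rule order_tendstoD)
  moreover have "\<forall>\<^sub>F \<mu> in at_left (lam 0). \<mu> \<in> {\<bar>lam 1\<bar><..<lam 0}"
    using gap by (intro eventually_at_left_real) simp
  ultimately have "\<forall>\<^sub>F \<mu> in at_left (lam 0). g \<mu> > 0 \<and> \<mu> \<in> {\<bar>lam 1\<bar><..<lam 0}"
    by (rule eventually_conj)
  then obtain \<mu> where \<mu>: "g \<mu> > 0" "\<bar>lam 1\<bar> < \<mu>" "\<mu> < lam 0"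
    using eventually_happens'[OF trivial_limit_at_left_real] by auto
  have "(lam 0)\<^sup>2 - \<mu>\<^sup>2 > 0" using \<mu> by (simp add: power_strict_mono)
  moreover from this have "ffun lam v z (\<mu>\<^sup>2) = g \<mu> / ((lam 0)\<^sup>2 - \<mu>\<^sup>2)"
    by (simp add: ffun_eq lessThan_N g_def add_divide_distrib)
  ultimately have "ffun lam v z (\<mu>\<^sup>2) \<ge> 0" using \<mu> by simp
  then obtain c where "spectral_norm (A - hankel1 c z) \<le> \<mu>"
    using exists_hankel1_error_le_iff[of \<mu> z] \<mu> by auto
  then show ?thesis using \<mu> by (intro exI[of _ c] exI[of _ z]) simp
qed

lemma optimal_errorD:
  assumes "optimal_hankel1 A ct zt"
  shows "spectral_norm (A - hankel1 ct zt) \<le> spectral_norm (A - hankel1 c z)"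
  using assms by (auto simp: optimal_hankel1_def is_arg_min_def not_less)

lemma optimal_error_eq_lam1_iff:
  assumes "optimal_hankel1 A ct zt"
  shows "spectral_norm (A - hankel1 ct zt) \<le> \<bar>lam 1\<bar> \<longleftrightarrow> (\<exists>z. cond_i lam v z)"
  using exists_hankel1_error_le_lam1_iff optimal_errorD[OF assms] by (meson order_trans)

lemma optimal_error_characterization:
  assumes opt: "optimal_hankel1 A ct zt" and no: "\<nexists>z. cond_i lam v z"
  defines "lt \<equiv> spectral_norm (A - hankel1 ct zt)"
  shows "lt \<in> {\<bar>lam 1\<bar><..<lam 0}"
    and "is_arg_min (\<lambda>l. l) (\<lambda>l. l \<in> {\<bar>lam 1\<bar><..<lam 0} \<and> has_max (\<lambda>z. ffun lam v z (l\<^sup>2)) 0) lt"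
    and "is_arg_max (\<lambda>z. ffun lam v z (lt\<^sup>2)) (\<lambda>_. True) zt"
    and "ct = inverse (\<Sum>k<CARD('n). (v k \<bullet> zvec zt)\<^sup>2 / (lam k - lt))"
    and "ct > 0"
proof -
  have gt: "\<bar>lam 1\<bar> < lt"
    using optimal_error_eq_lam1_iff[OF opt] no by (auto simp: lt_def)
  have less: "lt < lam 0"
    using exists_error_less_lam0 optimal_errorD[OF opt] unfolding lt_def by (meson le_less_trans)
  show in_range: "lt \<in> {\<bar>lam 1\<bar><..<lam 0}" using gt less by simp
  \<comment> \<open>A positive value at any \<open>z\<close> would contradict optimality, while the
    error attained at \<open>zt\<close> forces a nonnegative value there; so the maximum is 0 and is
    attained at \<open>zt\<close>.\<close>
  have nonpos: "ffun lam v z (lt\<^sup>2) \<le> 0" for z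
    using exists_smaller_error[OF gt less, of z] optimal_errorD[OF opt]
    unfolding lt_def by (meson not_le)
  have "ffun lam v zt (lt\<^sup>2) \<ge> 0"
    using exists_hankel1_error_le_iff[OF gt less, of zt] lt_def by blast
  with nonpos[of zt] have zero: "ffun lam v zt (lt\<^sup>2) = 0" by simp
  show max: "is_arg_max (\<lambda>z. ffun lam v z (lt\<^sup>2)) (\<lambda>_. True) zt"
    using nonpos zero by (auto simp: is_arg_max_def not_less)
  \<comment> \<open>A zero of f at a competing level \<open>l\<close> yields an approximation with
    error at most \<open>l\<close>, which optimality compares with \<open>lt\<close>.\<close>
  have "lt \<le> l" if l: "l \<in> {\<bar>lam 1\<bar><..<lam 0}" "has_max (\<lambda>z. ffun lam v z (l\<^sup>2)) 0" for l
  proof -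
    obtain z where "ffun lam v z (l\<^sup>2) = 0" using l by (auto simp: has_max_def)
    then obtain c where "spectral_norm (A - hankel1 c z) \<le> l"
      using exists_hankel1_error_le_iff[of l z] l by auto
    then show ?thesis using optimal_errorD[OF opt, of c z] by (simp add: lt_def)
  qed
  then show "is_arg_min (\<lambda>l. l)
      (\<lambda>l. l \<in> {\<bar>lam 1\<bar><..<lam 0} \<and> has_max (\<lambda>z. ffun lam v z (l\<^sup>2)) 0) lt"
    using in_range max zero unfolding is_arg_min_def has_max_def by (metis not_le)
  let ?S = "\<Sum>j<CARD('n). (v j \<bullet> zvec zt)\<^sup>2 / (lam j - lt)"
  let ?T = "\<Sum>j<CARD('n). (v j \<bullet> zvec zt)\<^sup>2 / (lam j + lt)"
  have bounds: "ct > 0 \<and> ?T \<le> 1 / ct \<and> 1 / ct \<le> ?S"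
    using spectral_norm_le_iff_bounds[of lt ct "zvec zt"] gt less
    by (auto simp: lt_def hankel1_eq_outer)
  \<comment> \<open>Since f vanishes at \<open>zt\<close>, the admissible interval for
    \<open>1 / ct\<close> shrinks to a single point.\<close>
  have "?S - ?T = 2 * lt * ffun lam v zt (lt\<^sup>2)"
    unfolding ffun_eq using abs_lam_neq[OF gt less] gt by (intro sum_minus_diff_sum_plus) auto
  then have "1 / ct = ?S" using bounds zero by simp
  then show "ct = inverse ?S" by (metis inverse_eq_divide inverse_inverse_eq)
  show "ct > 0" using bounds by simp
qed

end

theorem theorem4p5:
  fixes A :: "real ^ 'n::{finite,linorder} ^ 'n::{finite,linorder}"
    and lam :: "nat \<Rightarrow> real"
    and v :: "nat \<Rightarrow> real ^ 'n::{finite,linorder}"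
    and ct :: real
    and zt :: rbar
  assumes N_ge_2: "CARD('n) \<ge> 2"
    and symmetric: "transpose A = A"
    and rank_gt_1: "rank A > 1"
    and eigen: "\<And>j. j < CARD('n) \<Longrightarrow> A *v v j = lam j *\<^sub>R v j"
    and orthonormal:
      "\<And>i j. i < CARD('n) \<Longrightarrow> j < CARD('n) \<Longrightarrow> v i \<bullet> v j = (if i = j then 1 else 0)"
    and ordered: "\<And>i j. i \<le> j \<Longrightarrow> j < CARD('n) \<Longrightarrow> \<bar>lam j\<bar> \<le> \<bar>lam i\<bar>"
    and lam0_norm: "lam 0 = spectral_norm A"
    and gap: "lam 0 > \<bar>lam 1\<bar>"
    and optimal: "optimal_hankel1 A ct zt"
  shows
    "((spectral_norm (A - hankel1 ct zt))\<^sup>2 = (lam 1)\<^sup>2 \<longleftrightarrow> (\<exists>z. cond_i lam v z)) \<and>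
     (\<forall>z c. c \<noteq> 0 \<longrightarrow>
        ((spectral_norm (A - hankel1 c z))\<^sup>2 = (lam 1)\<^sup>2 \<longleftrightarrow>
         cond_i lam v z \<and> cond_ii lam v z c)) \<and>
     (\<not> (\<exists>z. cond_i lam v z) \<longrightarrow>
        (let lt = spectral_norm (A - hankel1 ct zt) in
           lt \<in> {\<bar>lam 1\<bar><..<lam 0} \<and>
           is_arg_min (\<lambda>l. l)
             (\<lambda>l. l \<in> {\<bar>lam 1\<bar><..<lam 0} \<and> has_max (\<lambda>z. ffun lam v z (l\<^sup>2)) 0) lt \<and>
           is_arg_max (\<lambda>z. ffun lam v z (lt\<^sup>2)) (\<lambda>_. True) zt \<and>
           ct = inverse (\<Sum>k<CARD('n). (v k \<bullet> zvec zt)\<^sup>2 / (lam k - lt)) \<and>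
           invertible (A - lt *\<^sub>R mat 1) \<and>
           ct = inverse (zvec zt \<bullet> (matrix_inv (A - lt *\<^sub>R mat 1) *v zvec zt)) \<and>
           ct > 0))"
proof -
  interpret dominant_hankel A lam v
    by unfold_locales (fact symmetric eigen orthonormal N_ge_2 ordered gap rank_gt_1)+
  let ?lt = "spectral_norm (A - hankel1 ct zt)"
  have part2: "?lt \<in> {\<bar>lam 1\<bar><..<lam 0} \<and>
      is_arg_min (\<lambda>l. l)
        (\<lambda>l. l \<in> {\<bar>lam 1\<bar><..<lam 0} \<and> has_max (\<lambda>z. ffun lam v z (l\<^sup>2)) 0) ?lt \<and>
      is_arg_max (\<lambda>z. ffun lam v z (?lt\<^sup>2)) (\<lambda>_. True) zt \<and>
      ct = inverse (\<Sum>k<CARD('n). (v k \<bullet> zvec zt)\<^sup>2 / (lam k - ?lt)) \<and>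
      invertible (A - ?lt *\<^sub>R mat 1) \<and>
      ct = inverse (zvec zt \<bullet> (matrix_inv (A - ?lt *\<^sub>R mat 1) *v zvec zt)) \<and>
      ct > 0" if no: "\<nexists>z. cond_i lam v z"
  proof -
    note char = optimal_error_characterization[OF optimal no]
    \<comment> \<open>The optimal error lies strictly inside the spectral gap, so it is not an
      eigenvalue and the resolvent exists.\<close>
    have neq: "lam j \<noteq> ?lt" if "j < CARD('n)" for j
      using char(1) abs_lam_neq[of ?lt j] that by auto
    show ?thesis
    proof (intro conjI)
      show "invertible (A - ?lt *\<^sub>R mat 1)"
        by (rule shifted_resolvent(1)) (rule neq)
      have "zvec zt \<bullet> (matrix_inv (A - ?lt *\<^sub>R mat 1) *v zvec zt) =
          (\<Sum>k<CARD('n). (v k \<bullet> zvec zt)\<^sup>2 / (lam k - ?lt))"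
        by (rule shifted_resolvent(2)) (rule neq)
      then show "ct = inverse (zvec zt \<bullet> (matrix_inv (A - ?lt *\<^sub>R mat 1) *v zvec zt))"
        by (rule ssubst) (rule char(4))
    qed (fact char)+
  qed
  show ?thesis
    unfolding Let_def hankel1_error_squared_eq_iff
    using part2 optimal_error_eq_lam1_iff[OF optimal] hankel1_error_le_lam1_iff by blast
qed

end
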